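(* For every integer $n\ge 1$, $$\det(A(2,n))=\begin{cases}(-1)^{n/2}(n+1) & \text{if } n \text{ is even},\\ 0 & \text{if } n\text{ is odd}.\end{cases}$$
   Context: For an integer $n\ge 1$, let $I_n$ be the $n\times n$ identity matrix and let $T_n$ be the $n\times n$ tridiagonal matrix whose entries on the main diagonal, the first superdiagonal and the first subdiagonal are all equal to $1$, all other entries being $0$ (so $T_1=[1]$). The matrix $A(2,n)$ is the $2n\times 2n$ block matrix $$A(2,n)=\begin{bmatrix} T_n & I_n\\ I_n & T_n\end{bmatrix}.$$ Its entries are regarded as real numbers (integers), and the determinant is computed over $\mathbb{R}$. *)

theory Defs
  imports Complex_Main "Jordan_Normal_Form.Determinant"
begin

definition T :: "nat \<Rightarrow> real mat" where
  "T n = mat n n (\<lambda>(i, j). if j = i \<or> j = Suc i \<or> i = Suc j then 1 else 0)"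

(* A2 n is the matrix A(2,n). *)
definition A2 :: "nat \<Rightarrow> real mat" where
  "A2 n = four_block_mat (T n) (1\<^sub>m n) (1\<^sub>m n) (T n)"

end

(*
  The two off-diagonal blocks are identities, so det A(2,n) = det (T^2 - I) = det (T - I) * det (T + I).
  Both factors are tridiagonal Toeplitz determinants with ones next to the diagonal, which satisfy the
  three-term recurrence D(n+2) = c * D(n+1) - D(n) with diagonal entry c = 0 and c = 2 respectively.
*)
theory Submission
  imports Defs
begin

text \<open>The diagonal entry is a parameter so that one recurrence serves both factors.\<close>

definition tridiag :: "'a :: comm_ring_1 \<Rightarrow> nat \<Rightarrow> 'a mat" where
  "tridiag c n = mat n n (\<lambda>(i, j). if j = i then c else if j = Suc i \<or> i = Suc j then 1 else 0)"

lemma tridiag_carrier [simp]: "tridiag c n \<in> carrier_mat n n"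
  by (simp add: tridiag_def)

lemma det_tridiag_0: "det (tridiag c 0) = 1"
  by (rule det_dim_zero) simp

lemma det_tridiag_1: "det (tridiag c (Suc 0)) = c"
  by (subst det_single) (auto simp: tridiag_def)

text \<open>Laplace expansion along row 0 leaves two terms. The minor at (0, 1) is not tridiagonal
  of the same shape, so it is expanded once more, along its first column.\<close>

lemma det_tridiag_Suc_Suc:
  "det (tridiag c (Suc (Suc n))) = c * det (tridiag c (Suc n)) - det (tridiag c n)"
proof -
  let ?A = "tridiag c (Suc (Suc n))"
  let ?B = "mat_delete ?A 0 1"
  have del0: "mat_delete ?A 0 0 = tridiag c (Suc n)"
    by (rule eq_matI) (auto simp: mat_delete_def tridiag_def)
  have B: "?B \<in> carrier_mat (Suc n) (Suc n)"
    by (rule carrier_matI) (auto simp: mat_delete_def tridiag_def)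
  have delB: "mat_delete ?B 0 0 = tridiag c n"
    by (rule eq_matI) (auto simp: mat_delete_def tridiag_def)
  have "det ?B = (\<Sum>i<Suc n. ?B $$ (i, 0) * cofactor ?B i 0)"
    by (rule laplace_expansion_column[OF B]) simp
  \<comment> \<open>Column 0 of \<open>?A\<close> vanishes below row 1, and row 0 is deleted in
    \<open>?B\<close>; only the subdiagonal 1 survives, now at the top.\<close>
  also have "\<dots> = (\<Sum>i\<in>{0}. ?B $$ (i, 0) * cofactor ?B i 0)"
    by (rule sum.mono_neutral_right) (auto simp: mat_delete_def tridiag_def)
  also have "\<dots> = det (tridiag c n)"
  proof -
    have "?B $$ (0, 0) = 1"
      by (simp add: mat_delete_def tridiag_def)
    then show ?thesis
      using delB by (simp add: cofactor_def)
  qed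
  finally have detB: "det ?B = det (tridiag c n)" .
  have "det ?A = (\<Sum>j<Suc (Suc n). ?A $$ (0, j) * cofactor ?A 0 j)"
    by (rule laplace_expansion_row) simp_all
  also have "\<dots> = (\<Sum>j\<in>{0, 1}. ?A $$ (0, j) * cofactor ?A 0 j)"
    by (rule sum.mono_neutral_right) (auto simp: tridiag_def)
  \<comment> \<open>The minus sign is the cofactor sign at position (0, 1).\<close>
  also have "\<dots> = c * det (tridiag c (Suc n)) - det (tridiag c n)"
  proof -
    have "?A $$ (0, 0) = c" "?A $$ (0, 1) = 1"
      by (simp_all add: tridiag_def)
    then show ?thesis
      using detB by (simp add: cofactor_def del0)
  qed
  finally show ?thesis .
qed

lemma det_tridiag_zero:
  "det (tridiag 0 n) = (if even n then (-1) ^ (n div 2) else 0)"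
  by (induction n rule: induct_nat_012)
     (auto simp: det_tridiag_0 det_tridiag_1 det_tridiag_Suc_Suc)

text \<open>For c = 2 the recurrence says that consecutive differences are equal, so the values form
  an arithmetic progression starting 1, 2.\<close>

lemma det_tridiag_two:
  "det (tridiag 2 n) = of_nat (n + 1)"
  by (induction n rule: induct_nat_012)
     (auto simp: det_tridiag_0 det_tridiag_1 det_tridiag_Suc_Suc algebra_simps)

text \<open>The lower blocks \<open>1\<^sub>m n\<close> and \<open>B\<close> commute, so the block
  determinant collapses to that of a difference of squares, which factors for the same
  reason.\<close>

lemma det_four_block_mat_one:
  fixes B :: "'a :: idom mat"
  assumes B: "B \<in> carrier_mat n n"
  shows "det (four_block_mat B (1\<^sub>m n) (1\<^sub>m n) B) = det (B - 1\<^sub>m n) * det (B + 1\<^sub>m n)"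
proof -
  have "det (four_block_mat B (1\<^sub>m n) (1\<^sub>m n) B) = det (B * B - 1\<^sub>m n * 1\<^sub>m n)"
    using B by (intro det_four_block_mat) auto
  also have "B * B - 1\<^sub>m n * 1\<^sub>m n = (B - 1\<^sub>m n) * (B + 1\<^sub>m n)"
  proof -
    have "(B - 1\<^sub>m n) * (B + 1\<^sub>m n) = (B * B + B) - (B + 1\<^sub>m n)"
      using B by (simp add: minus_mult_distrib_mat[of B n n "1\<^sub>m n" "B + 1\<^sub>m n" n]
        mult_add_distrib_mat[of B n n B n "1\<^sub>m n"])
    also have "\<dots> = B * B - 1\<^sub>m n * 1\<^sub>m n"
      using B by (intro eq_matI) auto
    finally show ?thesis by simp
  qed
  finally show ?thesis
    using B by (simp add: det_mult[of "B - 1\<^sub>m n" n "B + 1\<^sub>m n"] minus_carrier_mat)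
qed

theorem mainTheorem2:
  fixes n :: nat
  assumes "n \<ge> 1"
  shows "det (A2 n) = (if even n then (-1) ^ (n div 2) * (real n + 1) else 0)"
proof -
  \<comment> \<open>The diagonal of \<open>T n\<close> is 1, so the shifts by the identity give 0
    and 2. The first factor supplies the sign and the vanishing for odd n, the second the factor n +
    1.\<close>
  have "T n - 1\<^sub>m n = tridiag 0 n" "T n + 1\<^sub>m n = tridiag 2 n"
    by (rule eq_matI; auto simp: T_def tridiag_def)+
  moreover have "T n \<in> carrier_mat n n"
    by (simp add: T_def)
  ultimately show ?thesis
    by (simp add: A2_def det_four_block_mat_one det_tridiag_zero det_tridiag_two)
qed

end
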